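(* Let $\mathcal{D}$ be a finite dictionary in a Hilbert space $\mathcal{H}$. Let $\mathcal{D}_1\subset\mathcal{D}$ satisfy the conditions $M(\mathcal{D})\le\mu$, $M^+(\mathcal{D}_1,\mathcal{D})\le\mu^+$ for some positive numbers $\mu,\mu^+$ such that $$ \mu+2\mu^+<1. $$ Suppose that we observe a signal $$ y=\sum_{k=1}^K c_kg_k+w,\qquad g_k\in\mathcal{D}_1. $$ Given $\theta>0$, denote $\hat\beta:=2\theta/(1-\mu-2\mu^+)$ and assume that the noise $w$ satisfies the condition $\|w\|_{\mathcal{D}}\le\theta$. Then the OMP algorithm with the dictionary $\mathcal{D}$, the initial vector $y$ and the stopping criterion $$ \|r_l\|_{\mathcal{D}}\le\hat\theta:=\frac{\theta(1+\mu)}{1-\mu-2\mu^+} $$ (where $r_l$ is the residual after $l$ steps) has the following properties: (i) it selects only "true" dictionary elements, i.e. elements from $\{g_k\}_{k=1}^K$; (ii) it selects all elements $g_k$ with the coefficients $|c_k|>\hat\beta$.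
   Context: A dictionary in a Hilbert space $\mathcal{H}$ is a system $\mathcal{D}$ of elements of $\mathcal{H}$ with $\|g\|\le1$ for all $g\in\mathcal{D}$ and with span dense in $\mathcal{H}$. Notation: $$\|f\|_{\mathcal{D}}:=\sup_{g\in\mathcal{D}}|\langle f,g\rangle|,\qquad M(\mathcal{D}):=\sup_{g\ne h;\,g,h\in\mathcal{D}}|\langle h,g\rangle|,$$ $$M^+(\mathcal{D}_1,\mathcal{D}):=\max_{g\in\mathcal{D}}\Big\{\sum_{h\in\mathcal{D}_1}|\langle g,h\rangle|-\max_{h\in\mathcal{D}_1}|\langle g,h\rangle|\Big\}.$$ Orthogonal Matching Pursuit (OMP) with initial vector $y$: set $r_0:=y$. For $l=1,2,\dots$: if $r_{l-1}$ satisfies the stopping criterion, stop; otherwise choose (select) any $\psi_l\in\mathcal{D}$ maximizing $|\langle r_{l-1},g\rangle|$ over $g\in\mathcal{D}$, and set $r_l:=y-P_l y$, where $P_l$ is the orthogonal projection onto $\operatorname{span}(\psi_1,\dots,\psi_l)$.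
   Formalization: The elements g_k of the signal are additionally assumed to have norm exactly 1 and to be pairwise distinct; with only ‖g‖ ≤ 1, or with repeated g_k whose coefficients cancel, property (ii) fails. *)

theory Defs
  imports "HOL-Analysis.Analysis" "HOL-Library.Extended_Nat"
begin

text \<open>Real and complex Hilbert spaces are treated uniformly. By the Gelfand-Mazur theorem, a
  type of class \<^class>\<open>real_normed_field\<close> is isomorphic to the reals or to the complex
  numbers, with the usual absolute value as norm. Conjugation is then determined by
  \<open>a * conj a = |a|\<^sup>2\<close>.\<close>

definition scalar_conj :: "'k::real_normed_field \<Rightarrow> 'k" where
  "scalar_conj a = of_real ((norm a)\<^sup>2) / a"

lemma scalar_conj_real: "scalar_conj (a::real) = a"
  by (simp add: scalar_conj_def power2_eq_square)

lemma scalar_conj_complex: "scalar_conj a = cnj a"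
proof (cases "a = 0")
  case False
  have "of_real ((norm a)\<^sup>2) = a * cnj a"
    by (rule complex_norm_square)
  with False show ?thesis
    by (simp add: scalar_conj_def)
qed (simp add: scalar_conj_def)

text \<open>Completeness and the topology come from class \<^class>\<open>banach\<close>; the inner product is
  linear in the first argument and induces the norm of the type.\<close>

locale hilbert_space = vector_space smul
  for smul :: "'k::real_normed_field \<Rightarrow> 'a::banach \<Rightarrow> 'a" +
  fixes ip :: "'a \<Rightarrow> 'a \<Rightarrow> 'k"
  assumes scale_of_real: "smul (of_real t) x = t *\<^sub>R x"
    and ip_add_left: "ip (x + y) z = ip x z + ip y z"
    and ip_scale_left: "ip (smul a x) z = a * ip x z"
    and ip_conj_sym: "ip y x = scalar_conj (ip x y)"
    and ip_self: "ip x x = of_real ((norm x)\<^sup>2)"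

lemma hilbert_space_real:
  "hilbert_space (scaleR :: real \<Rightarrow> 'a \<Rightarrow> 'a) (inner :: 'a::{real_inner,banach} \<Rightarrow> 'a \<Rightarrow> real)"
  by unfold_locales
    (auto simp: scalar_conj_real inner_add_left inner_commute power2_norm_eq_inner algebra_simps)

lemma hilbert_space_complex:
  "hilbert_space ((*) :: complex \<Rightarrow> complex \<Rightarrow> complex) (\<lambda>x y. x * cnj y)"
  by unfold_locales
    (auto simp: scalar_conj_complex scaleR_conv_of_real complex_norm_square algebra_simps
          simp del: of_real_power)

definition is_dictionary :: "('k::real_normed_field \<Rightarrow> 'a::banach \<Rightarrow> 'a) \<Rightarrow> 'a set \<Rightarrow> bool" where
  "is_dictionary smul D \<longleftrightarrow> (\<forall>g\<in>D. norm g \<le> 1) \<and> closure (module.span smul D) = UNIV"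

text \<open>All suprema and maxima below range over non-negative numbers. Inserting 0 changes nothing
  except that it gives the value 0 over an empty range (e.g. the coherence of a
  one-element dictionary), where \<^const>\<open>Sup\<close> and \<^const>\<open>Max\<close> are unspecified.\<close>

definition dict_norm :: "('a \<Rightarrow> 'a \<Rightarrow> 'k::real_normed_field) \<Rightarrow> 'a set \<Rightarrow> 'a \<Rightarrow> real" where
  "dict_norm ip D f = Sup (insert 0 {norm (ip f g) |g. g \<in> D})"

definition coherence :: "('a \<Rightarrow> 'a \<Rightarrow> 'k::real_normed_field) \<Rightarrow> 'a set \<Rightarrow> real" where
  "coherence ip D = Sup (insert 0 {norm (ip h g) |g h. g \<in> D \<and> h \<in> D \<and> g \<noteq> h})"

definition coherence_plus ::
    "('a \<Rightarrow> 'a \<Rightarrow> 'k::real_normed_field) \<Rightarrow> 'a set \<Rightarrow> 'a set \<Rightarrow> real" where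
  "coherence_plus ip D\<^sub>1 D =
     Max (insert 0 ((\<lambda>g. (\<Sum>h\<in>D\<^sub>1. norm (ip g h)) - Max (insert 0 ((\<lambda>h. norm (ip g h)) ` D\<^sub>1))) ` D))"

definition is_orth_proj :: "('a::ab_group_add \<Rightarrow> 'a \<Rightarrow> 'k::real_normed_field) \<Rightarrow> 'a set \<Rightarrow> 'a \<Rightarrow> 'a \<Rightarrow> bool" where
  "is_orth_proj ip S y p \<longleftrightarrow> p \<in> S \<and> (\<forall>v\<in>S. ip (y - p) v = 0)"

text \<open>\<open>omp_run smul ip D y stop \<psi> r N\<close>: the sequences \<open>\<psi> 1, \<psi> 2, \<dots>\<close> (selected elements) and
  \<open>r 0, r 1, \<dots>\<close> (residuals) record a complete execution of OMP that performs exactly \<open>N\<close>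
  selection steps. The case \<open>N = \<infinity>\<close> is an execution that never stops; values
  of \<open>\<psi>\<close> and \<open>r\<close> beyond \<open>N\<close> are irrelevant.\<close>

definition omp_run ::
    "('k::real_normed_field \<Rightarrow> 'a::banach \<Rightarrow> 'a) \<Rightarrow> ('a \<Rightarrow> 'a \<Rightarrow> 'k) \<Rightarrow> 'a set \<Rightarrow> 'a \<Rightarrow> ('a \<Rightarrow> bool)
      \<Rightarrow> (nat \<Rightarrow> 'a) \<Rightarrow> (nat \<Rightarrow> 'a) \<Rightarrow> enat \<Rightarrow> bool" where
  "omp_run smul ip D y stop \<psi> r N \<longleftrightarrow>
     r 0 = y \<and>
     (\<forall>l\<ge>1. enat l \<le> N \<longrightarrow>
        \<not> stop (r (l - 1)) \<and>
        \<psi> l \<in> D \<and> (\<forall>g\<in>D. norm (ip (r (l - 1)) g) \<le> norm (ip (r (l - 1)) (\<psi> l))) \<and>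
        (\<exists>p. is_orth_proj ip (module.span smul (\<psi> ` {1..l})) y p \<and> r l = y - p)) \<and>
     (\<forall>n. N = enat n \<longrightarrow> stop (r n))"

definition omp_selected :: "(nat \<Rightarrow> 'a) \<Rightarrow> enat \<Rightarrow> 'a set" where
  "omp_selected \<psi> N = {\<psi> l |l. 1 \<le> l \<and> enat l \<le> N}"

end

theory Submission
  imports Defs
begin

text \<open>Every residual is \<open>\<Sum>h\<in>T. a h \<cdot> h + w\<close>, where \<open>T = {g\<^sub>1, \<dots>, g\<^sub>K}\<close>, as long as only elements
  of \<open>T\<close> have been selected. If \<open>A = max |a h|\<close> is attained at \<open>h\<^sub>0\<close>, incoherence gives
  \<open>|\<langle>r, h\<^sub>0\<rangle>| \<ge> A (1 - \<mu>\<^sup>+) - \<theta>\<close>, whereas \<open>|\<langle>r, g\<rangle>| \<le> A (\<mu> + \<mu>\<^sup>+) + \<theta>\<close> for \<open>g\<close> outside \<open>T\<close>.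
  The first bound exceeds the second once \<open>A > \<beta>\<close>, so a false element can only maximise when
  \<open>A \<le> \<beta>\<close>; but then its inner product with \<open>r\<close> is at most \<open>\<theta>'\<close> and OMP has already stopped.
  Conversely, stopping forces \<open>A \<le> \<beta>\<close>, and \<open>a g\<^sub>k = c\<^sub>k\<close> for every unselected \<open>g\<^sub>k\<close>. The algorithm does
  stop: residuals are orthogonal to all selected elements, so no element is selected twice.\<close>

text \<open>Omitting the maximiser over \<open>T\<close> leaves at most \<open>m\<close>; if it lies
  in \<open>S\<close>, restoring it costs at most \<open>b\<close>. As it may also lie outside
  \<open>S\<close>, a bound for \<open>f\<close> on \<open>S\<close> suffices.\<close>

lemma sum_le_of_sum_minus_Max:
  fixes f :: "'a \<Rightarrow> real"
  assumes "finite T" "S \<subseteq> T" and nonneg: "\<And>h. h \<in> T \<Longrightarrow> 0 \<le> f h"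
    and T: "sum f T - Max (insert 0 (f ` T)) \<le> m"
    and "0 \<le> b" and b: "\<And>h. h \<in> S \<Longrightarrow> f h \<le> b"
  shows "sum f S \<le> m + b"
proof -
  have "Max (insert 0 (f ` T)) \<in> insert 0 (f ` T)"
    using \<open>finite T\<close> by (intro Max_in) auto
  \<comment> \<open>The value 0 is the default inserted in the maximum and covers empty
    \<open>T\<close>.\<close>
  then consider "Max (insert 0 (f ` T)) = 0" | h where "h \<in> T" "Max (insert 0 (f ` T)) = f h"
    by blast
  then show ?thesis
  proof cases
    case 1
    have "sum f S \<le> sum f T"
      by (rule sum_mono2) (use assms in auto)
    with 1 T \<open>0 \<le> b\<close> show ?thesis by simp
  next
    case (2 h)
    have "sum f (S - {h}) \<le> sum f (T - {h})"
      by (rule sum_mono2) (use assms in auto)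
    also have "\<dots> = sum f T - f h"
      using \<open>finite T\<close> 2 by (simp add: sum_diff1)
    also have "\<dots> \<le> m" using T 2 by simp
    finally have "sum f (S - {h}) \<le> m" .
    moreover have "sum f S \<le> sum f (S - {h}) + b"
      using b \<open>0 \<le> b\<close> finite_subset[OF \<open>S \<subseteq> T\<close> \<open>finite T\<close>] by (simp add: sum_diff1)
    ultimately show ?thesis by simp
  qed
qed

section \<open>Dictionary norm and coherence of a finite dictionary\<close>

lemma dict_norm_le_iff:
  assumes "finite D" "0 \<le> b"
  shows "dict_norm ip D v \<le> b \<longleftrightarrow> (\<forall>g\<in>D. norm (ip v g) \<le> b)"
  unfolding dict_norm_def using assms by (subst cSup_le_iff) (auto simp: Setcompr_eq_image)

lemma norm_ip_le_coherence:
  assumes "finite D" "g \<in> D" "h \<in> D" "g \<noteq> h"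
  shows "norm (ip h g) \<le> coherence ip D"
  unfolding coherence_def
proof (rule cSup_upper)
  have "{norm (ip h g) |g h. g \<in> D \<and> h \<in> D \<and> g \<noteq> h} \<subseteq> (\<lambda>(g, h). norm (ip h g)) ` (D \<times> D)"
    by auto
  then have "finite {norm (ip h g) |g h. g \<in> D \<and> h \<in> D \<and> g \<noteq> h}"
    using \<open>finite D\<close> by (meson finite_SigmaI finite_imageI finite_subset)
  then show "bdd_above (insert 0 {norm (ip h g) |g h. g \<in> D \<and> h \<in> D \<and> g \<noteq> h})"
    by simp
qed (use assms in auto)

lemma coherence_plus_ge:
  assumes "finite D" "g \<in> D"
  shows "(\<Sum>h\<in>D\<^sub>1. norm (ip g h)) - Max (insert 0 ((\<lambda>h. norm (ip g h)) ` D\<^sub>1)) \<le> coherence_plus ip D\<^sub>1 D"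
  unfolding coherence_plus_def by (rule Max_ge) (use assms in auto)

section \<open>Inner products with combinations of incoherent elements\<close>

context hilbert_space
begin

lemma ip_zero_left: "ip 0 z = 0"
  using ip_add_left[of 0 0 z] by simp

lemma ip_sum_left: "ip (\<Sum>h\<in>S. f h) z = (\<Sum>h\<in>S. ip (f h) z)"
  by (induction S rule: infinite_finite_induct) (auto simp: ip_zero_left ip_add_left)

lemma norm_ip_commute: "norm (ip x y) = norm (ip y x)"
  by (subst ip_conj_sym) (simp add: scalar_conj_def norm_divide norm_mult power2_eq_square)

lemma ip_combination_left:
  "ip ((\<Sum>h\<in>S. smul (a h) h) + w) z = (\<Sum>h\<in>S. a h * ip h z) + ip w z"
  by (simp add: ip_add_left ip_sum_left ip_scale_left)

text \<open>The diagonal term is 1 by unit norm and no other term exceeds the coherence, so the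
  maximum subtracted in M^+ is at most 1, which is what removing \<open>g\<close> takes
  away.\<close>

lemma sum_norm_ip_other_le:
  assumes "finite D" "D\<^sub>1 \<subseteq> D" "coherence ip D \<le> 1" "S \<subseteq> D\<^sub>1" "g \<in> S" "norm g = 1"
  shows "(\<Sum>h\<in>S - {g}. norm (ip g h)) \<le> coherence_plus ip D\<^sub>1 D"
proof -
  have fin: "finite D\<^sub>1" using assms finite_subset by blast
  have g: "norm (ip g g) = 1" using \<open>norm g = 1\<close> by (simp add: ip_self)
  have "norm (ip g h) \<le> 1" if "h \<in> D\<^sub>1" for h
  proof (cases "h = g")
    case False
    then have "norm (ip g h) \<le> coherence ip D"
      using assms that by (intro norm_ip_le_coherence) auto
    with assms show ?thesis by simp
  qed (simp add: g)
  then have Max: "Max (insert 0 ((\<lambda>h. norm (ip g h)) ` D\<^sub>1)) \<le> 1"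
    using fin by simp
  have "(\<Sum>h\<in>S - {g}. norm (ip g h)) \<le> (\<Sum>h\<in>D\<^sub>1 - {g}. norm (ip g h))"
    by (rule sum_mono2) (use assms fin in auto)
  also have "\<dots> = (\<Sum>h\<in>D\<^sub>1. norm (ip g h)) - 1"
    using fin assms g by (subst sum_diff1) auto
  also have "\<dots> \<le> coherence_plus ip D\<^sub>1 D"
    using coherence_plus_ge[of D g ip D\<^sub>1] Max assms by auto
  finally show ?thesis .
qed

text \<open>The maximum subtracted in M^+ may belong to a term of \<open>S\<close>. As
  \<open>g\<close> is not in \<open>S\<close>, that term is off-diagonal, so restoring it costs at
  most \<open>\<mu>\<close>.\<close>

lemma sum_norm_ip_outside_le:
  assumes "finite D" "D\<^sub>1 \<subseteq> D" "coherence ip D \<le> \<mu>" "0 \<le> \<mu>" "S \<subseteq> D\<^sub>1" "g \<in> D" "g \<notin> S"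
  shows "(\<Sum>h\<in>S. norm (ip g h)) \<le> coherence_plus ip D\<^sub>1 D + \<mu>"
proof (rule sum_le_of_sum_minus_Max[where T = D\<^sub>1])
  show "finite D\<^sub>1" using assms finite_subset by blast
  show "norm (ip g h) \<le> \<mu>" if "h \<in> S" for h
    using norm_ip_le_coherence[of D h g ip] assms that by fastforce
qed (use assms coherence_plus_ge[of D g ip D\<^sub>1] in auto)

lemma norm_ip_combination_le:
  assumes "\<And>h. h \<in> S \<Longrightarrow> norm (a h) \<le> A" "(\<Sum>h\<in>S. norm (ip z h)) \<le> s" "0 \<le> A"
  shows "norm (\<Sum>h\<in>S. a h * ip h z) \<le> A * s"
proof -
  have "norm (\<Sum>h\<in>S. a h * ip h z) \<le> (\<Sum>h\<in>S. A * norm (ip z h))"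
    using assms by (intro sum_norm_le) (auto simp: norm_mult norm_ip_commute[of z] intro!: mult_right_mono)
  also have "\<dots> \<le> A * s"
    using assms by (simp add: sum_distrib_left[symmetric] mult_left_mono)
  finally show ?thesis .
qed

text \<open>By unit norm \<open>h\<^sub>0\<close> contributes \<open>a h\<^sub>0\<close> in full;
  maximality of this coefficient bounds the other terms of the sum together by
  \<open>norm (a h\<^sub>0) * s\<close>.\<close>

lemma norm_ip_residual_ge:
  assumes "finite S" "h\<^sub>0 \<in> S" "norm h\<^sub>0 = 1" "\<And>h. h \<in> S \<Longrightarrow> norm (a h) \<le> norm (a h\<^sub>0)"
    and "(\<Sum>h\<in>S - {h\<^sub>0}. norm (ip h\<^sub>0 h)) \<le> s" "norm (ip w h\<^sub>0) \<le> \<theta>"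
  shows "norm (a h\<^sub>0) * (1 - s) - \<theta> \<le> norm (ip ((\<Sum>h\<in>S. smul (a h) h) + w) h\<^sub>0)"
proof -
  have "norm (\<Sum>h\<in>S - {h\<^sub>0}. a h * ip h h\<^sub>0) \<le> norm (a h\<^sub>0) * s"
    by (rule norm_ip_combination_le) (use assms in auto)
  moreover have "ip ((\<Sum>h\<in>S. smul (a h) h) + w) h\<^sub>0
      = a h\<^sub>0 + ((\<Sum>h\<in>S - {h\<^sub>0}. a h * ip h h\<^sub>0) + ip w h\<^sub>0)"
    unfolding ip_combination_left using assms by (simp add: sum.remove ip_self)
  ultimately show ?thesis
    using \<open>norm (ip w h\<^sub>0) \<le> \<theta>\<close>
      norm_diff_ineq[of "a h\<^sub>0" "(\<Sum>h\<in>S - {h\<^sub>0}. a h * ip h h\<^sub>0) + ip w h\<^sub>0"]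
      norm_triangle_ineq[of "\<Sum>h\<in>S - {h\<^sub>0}. a h * ip h h\<^sub>0" "ip w h\<^sub>0"]
    by (simp add: algebra_simps)
qed

lemma norm_ip_residual_le:
  assumes "\<And>h. h \<in> S \<Longrightarrow> norm (a h) \<le> A" "0 \<le> A"
    and "(\<Sum>h\<in>S. norm (ip z h)) \<le> s" "norm (ip w z) \<le> \<theta>"
  shows "norm (ip ((\<Sum>h\<in>S. smul (a h) h) + w) z) \<le> A * s + \<theta>"
  unfolding ip_combination_left
  using norm_ip_combination_le[OF assms(1,3,2)] assms(4) by (meson add_mono norm_triangle_le)

section \<open>Residuals and termination of OMP\<close>

lemma omp_residual_combination:
  assumes run: "omp_run smul ip D y stop \<psi> r N" and l: "enat l \<le> N"
    and "finite T" "\<psi> ` {1..l} \<subseteq> T" and y: "y = (\<Sum>h\<in>T. smul (b h) h) + w"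
  obtains a where "r l = (\<Sum>h\<in>T. smul (a h) h) + w" "\<And>h. h \<notin> \<psi> ` {1..l} \<Longrightarrow> a h = b h"
proof (cases "l = 0")
  case True
  then show ?thesis using run y that[of b] by (auto simp: omp_run_def)
next
  case False
  let ?S = "\<psi> ` {1..l}"
  obtain p where p: "p \<in> span ?S" "r l = y - p"
    using run l False unfolding omp_run_def is_orth_proj_def by (metis One_nat_def Suc_leI not_gr_zero)
  then obtain u where u: "p = (\<Sum>h\<in>?S. smul (u h) h)"
    by (auto simp: span_finite)
  \<comment> \<open>Padding with zeros writes \<open>p\<close> as a combination over
    \<open>T\<close>; subtracting it changes only coefficients of selected elements.\<close>
  define v where "v h = (if h \<in> ?S then u h else 0)" for h
  have "p = (\<Sum>h\<in>T. smul (v h) h)"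
    unfolding u by (rule sum.mono_neutral_cong_left) (use assms in \<open>auto simp: v_def\<close>)
  then have "r l = (\<Sum>h\<in>T. smul (b h - v h) h) + w"
    unfolding p(2) y by (simp add: scale_left_diff_distrib sum_subtractf)
  then show ?thesis by (rule that) (simp add: v_def)
qed

lemma omp_residual_orthogonal:
  assumes run: "omp_run smul ip D y stop \<psi> r N" and l: "enat l \<le> N" and "j \<in> {1..l}"
  shows "ip (r l) (\<psi> j) = 0"
proof -
  have "l \<ge> 1" using \<open>j \<in> {1..l}\<close> by auto
  with run l obtain p where "is_orth_proj ip (span (\<psi> ` {1..l})) y p" "r l = y - p"
    unfolding omp_run_def by metis
  then show ?thesis
    using \<open>j \<in> {1..l}\<close> unfolding is_orth_proj_def by (metis imageI span_base)
qed

lemma omp_terminates: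
  assumes run: "omp_run smul ip D y (\<lambda>v. dict_norm ip D v \<le> \<delta>) \<psi> r N" and "finite D" "0 \<le> \<delta>"
  shows "N \<noteq> \<infinity>"
proof
  assume N: "N = \<infinity>"
  have ne: "\<psi> i \<noteq> \<psi> j" if "1 \<le> i" "i < j" for i j
  proof
    assume eq: "\<psi> i = \<psi> j"
    \<comment> \<open>Step \<open>j\<close> maximises against \<open>r (j - 1)\<close>, which is
      already orthogonal to \<open>\<psi> i\<close> because \<open>i \<le> j - 1\<close>. So the
      maximum is 0 and OMP would have stopped.\<close>
    have "ip (r (j - 1)) (\<psi> i) = 0"
      using that N by (intro omp_residual_orthogonal[OF run]) auto
    then have "\<forall>g\<in>D. norm (ip (r (j - 1)) g) \<le> 0" and "\<not> dict_norm ip D (r (j - 1)) \<le> \<delta>"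
      using run that N eq unfolding omp_run_def by (force dest: spec[of _ j])+
    then show False
      using assms by (auto simp: dict_norm_le_iff)
  qed
  have "inj_on \<psi> {1..}"
    by (rule linorder_inj_onI) (use ne in auto)
  moreover have "\<psi> ` {1..} \<subseteq> D"
    using run N by (auto simp: omp_run_def)
  ultimately have "finite {1::nat..}"
    using \<open>finite D\<close> finite_imageD finite_subset by metis
  then show False by (simp add: infinite_Ici)
qed

end

text \<open>Unit norm of the \<open>g k\<close> gives the diagonal terms their value 1 in the lower
  bound. Since \<open>N\<close> may be infinite, termination is part of what is proved.\<close>

theorem theorem1p2:
  fixes smul :: "'k::real_normed_field \<Rightarrow> 'a::banach \<Rightarrow> 'a"
    and ip :: "'a \<Rightarrow> 'a \<Rightarrow> 'k"
    and D D\<^sub>1 :: "'a set"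
    and \<mu> \<mu>\<^sub>p \<theta> \<beta> \<theta>' :: real
    and K :: nat
    and c :: "nat \<Rightarrow> 'k"
    and g :: "nat \<Rightarrow> 'a"
    and w y :: 'a
    and \<psi> r :: "nat \<Rightarrow> 'a"
    and N :: enat
  assumes "hilbert_space smul ip"
    and "finite D"
    and "is_dictionary smul D"
    and "D\<^sub>1 \<subseteq> D"
    and "\<mu> > 0"
    and "\<mu>\<^sub>p > 0"
    and "coherence ip D \<le> \<mu>"
    and "coherence_plus ip D\<^sub>1 D \<le> \<mu>\<^sub>p"
    and "\<mu> + 2 * \<mu>\<^sub>p < 1"
    and "\<forall>k\<in>{1..K}. g k \<in> D\<^sub>1"
    and "inj_on g {1..K}"
    and "\<forall>k\<in>{1..K}. norm (g k) = 1"
    and "y = (\<Sum>k=1..K. smul (c k) (g k)) + w"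
    and "\<theta> > 0"
    and "\<beta> = 2 * \<theta> / (1 - \<mu> - 2 * \<mu>\<^sub>p)"
    and "dict_norm ip D w \<le> \<theta>"
    and "\<theta>' = \<theta> * (1 + \<mu>) / (1 - \<mu> - 2 * \<mu>\<^sub>p)"
    and "omp_run smul ip D y (\<lambda>v. dict_norm ip D v \<le> \<theta>') \<psi> r N"
  shows "omp_selected \<psi> N \<subseteq> g ` {1..K} \<and>
         (\<forall>k\<in>{1..K}. norm (c k) > \<beta> \<longrightarrow> g k \<in> omp_selected \<psi> N)"
proof -
  interpret hilbert_space smul ip by fact
  define T where "T = g ` {1..K}"
  \<comment> \<open>Coefficients become a function of the element, well defined because
    \<open>g\<close> is injective.\<close>
  define b where "b = c \<circ> the_inv_into {1..K} g"
  define s where "s = 1 - \<mu> - 2 * \<mu>\<^sub>p"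
  note fin = \<open>finite D\<close> and run = \<open>omp_run smul ip D y (\<lambda>v. dict_norm ip D v \<le> \<theta>') \<psi> r N\<close>
  have "s > 0" using assms by (simp add: s_def)
  have \<beta>: "\<beta> = 2 * \<theta> / s" and \<theta>': "\<theta>' = \<theta> * (1 + \<mu>) / s"
    using assms by (simp_all add: s_def)
  have pos: "\<beta> > 0" "\<theta>' > 0" using \<open>s > 0\<close> \<open>\<theta> > 0\<close> \<open>\<mu> > 0\<close> by (simp_all add: \<beta> \<theta>')
  have T: "finite T" "T \<subseteq> D\<^sub>1" and T_norm: "\<And>h. h \<in> T \<Longrightarrow> norm h = 1"
    using assms by (auto simp: T_def)
  have b: "b (g k) = c k" if "k \<in> {1..K}" for k
    using that \<open>inj_on g {1..K}\<close> by (simp add: b_def the_inv_into_f_f)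
  have y: "y = (\<Sum>h\<in>T. smul (b h) h) + w"
    unfolding T_def using assms b by (simp add: sum.reindex)
  have w: "norm (ip w h) \<le> \<theta>" if "h \<in> D" for h
    using that \<open>dict_norm ip D w \<le> \<theta>\<close> \<open>\<theta> > 0\<close> fin by (simp add: dict_norm_le_iff)
  have inside: "(\<Sum>h\<in>T - {h\<^sub>0}. norm (ip h\<^sub>0 h)) \<le> \<mu>\<^sub>p" if "h\<^sub>0 \<in> T" for h\<^sub>0
    using sum_norm_ip_other_le[OF fin \<open>D\<^sub>1 \<subseteq> D\<close> _ T(2) that T_norm[OF that]] assms by linarith
  have outside: "(\<Sum>h\<in>T. norm (ip z h)) \<le> \<mu>\<^sub>p + \<mu>" if "z \<in> D" "z \<notin> T" for z
    using sum_norm_ip_outside_le[of D D\<^sub>1 \<mu> T z] that T assms by linarith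
  \<comment> \<open>If some coefficient exceeds \<open>\<beta>\<close>, so does the largest one.
    Both claims use the lower bound at its position.\<close>
  have large: "\<exists>h\<^sub>0\<in>T. (\<forall>h\<in>T. norm (a h) \<le> norm (a h\<^sub>0)) \<and> \<beta> < norm (a h\<^sub>0) \<and>
      norm (a h\<^sub>0) * (1 - \<mu>\<^sub>p) - \<theta> \<le> norm (ip ((\<Sum>h\<in>T. smul (a h) h) + w) h\<^sub>0)"
    if "h \<in> T" "\<beta> < norm (a h)" for a h
  proof -
    have "Max ((\<lambda>h. norm (a h)) ` T) \<in> (\<lambda>h. norm (a h)) ` T"
      using T \<open>h \<in> T\<close> by (intro Max_in) auto
    then obtain h\<^sub>0 where "h\<^sub>0 \<in> T" and Max: "Max ((\<lambda>h. norm (a h)) ` T) = norm (a h\<^sub>0)"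
      by auto
    then have h\<^sub>0: "h\<^sub>0 \<in> T" "\<forall>h\<in>T. norm (a h) \<le> norm (a h\<^sub>0)"
      unfolding Max[symmetric] using T(1) by auto
    then have "norm (a h\<^sub>0) * (1 - \<mu>\<^sub>p) - \<theta> \<le> norm (ip ((\<Sum>h\<in>T. smul (a h) h) + w) h\<^sub>0)"
      using T T_norm inside w \<open>D\<^sub>1 \<subseteq> D\<close> by (intro norm_ip_residual_ge) auto
    with h\<^sub>0 that show ?thesis by fastforce
  qed
  have sel: "\<psi> ` {1..l} \<subseteq> T" if "enat l \<le> N" for l
    using that
  proof (induction l)
    case (Suc l)
    then have l: "enat l \<le> N" by (meson Suc_ile_eq order_less_imp_le)
    with Suc.IH obtain a where a: "r l = (\<Sum>h\<in>T. smul (a h) h) + w"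
      using omp_residual_combination[OF run l T(1) _ y] by metis
    have step: "\<not> dict_norm ip D (r l) \<le> \<theta>'" "\<psi> (Suc l) \<in> D"
        "\<And>h. h \<in> D \<Longrightarrow> norm (ip (r l) h) \<le> norm (ip (r l) (\<psi> (Suc l)))"
      using run Suc.prems unfolding omp_run_def by (force dest: spec[of _ "Suc l"])+
    have "\<psi> (Suc l) \<in> T"
    proof (rule ccontr)
      assume new: "\<psi> (Suc l) \<notin> T"
      \<comment> \<open>\<open>A\<close> is left free: it is taken as the largest coefficient in one
        case and as \<open>\<beta>\<close> in the other.\<close>
      have le: "norm (ip (r l) (\<psi> (Suc l))) \<le> A * (\<mu>\<^sub>p + \<mu>) + \<theta>"
        if "\<And>h. h \<in> T \<Longrightarrow> norm (a h) \<le> A" "0 \<le> A" for A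
        unfolding a using that outside[OF step(2) new] w[OF step(2)] by (rule norm_ip_residual_le)
      show False
      proof (cases "\<exists>h\<in>T. \<beta> < norm (a h)")
        case True
        then obtain h\<^sub>0 where h\<^sub>0: "h\<^sub>0 \<in> T" "\<forall>h\<in>T. norm (a h) \<le> norm (a h\<^sub>0)" "\<beta> < norm (a h\<^sub>0)"
            "norm (a h\<^sub>0) * (1 - \<mu>\<^sub>p) - \<theta> \<le> norm (ip (r l) h\<^sub>0)"
          unfolding a using large[of _ a] by blast
        have "norm (a h\<^sub>0) * (1 - \<mu>\<^sub>p) - \<theta> \<le> norm (a h\<^sub>0) * (\<mu>\<^sub>p + \<mu>) + \<theta>"
          using h\<^sub>0 step(3)[of h\<^sub>0] le[of "norm (a h\<^sub>0)"] T \<open>D\<^sub>1 \<subseteq> D\<close> by fastforce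
        \<comment> \<open>The difference of the two slopes,
          \<open>(1 - \<mu>\<^sub>p) - (\<mu>\<^sub>p + \<mu>)\<close>, is exactly
          \<open>s\<close>.\<close>
        then have "norm (a h\<^sub>0) * s \<le> 2 * \<theta>" by (simp add: s_def algebra_simps)
        then show False using h\<^sub>0(3) \<open>s > 0\<close> by (simp add: \<beta> field_simps)
      next
        case False
        then have "norm (ip (r l) (\<psi> (Suc l))) \<le> \<beta> * (\<mu>\<^sub>p + \<mu>) + \<theta>"
          using le[of \<beta>] pos by force
        \<comment> \<open>The stopping threshold is the upper bound evaluated at
          \<open>A = \<beta>\<close>, since
          \<open>2 * (\<mu>\<^sub>p + \<mu>) + s = 1 + \<mu>\<close>.\<close>
        also have "\<dots> = \<theta>'"
        proof -
          have "\<beta> * (\<mu>\<^sub>p + \<mu>) + \<theta> = \<theta> * (2 * (\<mu>\<^sub>p + \<mu>) + s) / s"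
            using \<open>s > 0\<close> by (simp add: \<beta> field_simps)
          then show ?thesis by (simp add: \<theta>' s_def algebra_simps)
        qed
        finally have "dict_norm ip D (r l) \<le> \<theta>'"
          using step(3) fin pos by (force simp: dict_norm_le_iff)
        with step(1) show False ..
      qed
    qed
    with Suc.IH[OF l] show ?case by (simp add: atLeastAtMostSuc_conv)
  qed simp
  \<comment> \<open>Only a finite run has a last residual that meets the stopping criterion.\<close>
  obtain n where n: "N = enat n"
    using omp_terminates[OF run fin] pos by fastforce
  have "g k \<in> omp_selected \<psi> N" if k: "k \<in> {1..K}" "\<beta> < norm (c k)" for k
  proof (rule ccontr)
    assume "g k \<notin> omp_selected \<psi> N"
    then have "g k \<notin> \<psi> ` {1..n}" by (auto simp: omp_selected_def n)
    moreover obtain a where a: "r n = (\<Sum>h\<in>T. smul (a h) h) + w"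
        "\<And>h. h \<notin> \<psi> ` {1..n} \<Longrightarrow> a h = b h"
      using omp_residual_combination[OF run _ T(1) sel y] n by (metis order_refl)
    ultimately have "\<beta> < norm (a (g k))" using k b by simp
    then obtain h\<^sub>0 where h\<^sub>0: "h\<^sub>0 \<in> T" "\<beta> < norm (a h\<^sub>0)"
        "norm (a h\<^sub>0) * (1 - \<mu>\<^sub>p) - \<theta> \<le> norm (ip (r n) h\<^sub>0)"
      unfolding a(1) using large[of "g k" a] k by (auto simp: T_def)
    have "norm (ip (r n) h\<^sub>0) \<le> \<theta>'"
      using run n fin pos h\<^sub>0(1) T \<open>D\<^sub>1 \<subseteq> D\<close> by (auto simp: omp_run_def dict_norm_le_iff)
    \<comment> \<open>The lower bound at \<open>\<beta>\<close> is the same threshold, as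
      \<open>2 * (1 - \<mu>\<^sub>p) - s = 1 + \<mu>\<close>; a coefficient beyond
      \<open>\<beta>\<close> thus contradicts stopping.\<close>
    moreover have "\<theta>' = \<beta> * (1 - \<mu>\<^sub>p) - \<theta>"
    proof -
      have "\<beta> * (1 - \<mu>\<^sub>p) - \<theta> = \<theta> * (2 * (1 - \<mu>\<^sub>p) - s) / s"
        using \<open>s > 0\<close> by (simp add: \<beta> field_simps)
      then show ?thesis by (simp add: \<theta>' s_def algebra_simps)
    qed
    moreover have "\<beta> * (1 - \<mu>\<^sub>p) < norm (a h\<^sub>0) * (1 - \<mu>\<^sub>p)"
      using h\<^sub>0(2) assms by (intro mult_strict_right_mono) auto
    ultimately show False using h\<^sub>0(3) by linarith
  qed
  moreover have "omp_selected \<psi> N \<subseteq> T"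
    using sel by (fastforce simp: omp_selected_def)
  ultimately show ?thesis by (simp add: T_def)
qed

end
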